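(* The period of an integer $n$ has size $O(\log n)$: there exists a constant $C>0$ such that for every integer $n\ge 2$ the period $k(n)$ of $n$ satisfies $k(n)\le C\log n$.
   Context: For a positive integer $n$, $d(n)$ denotes the number of positive divisors of $n$, and $d^{k}$ denotes the $k$-fold iterate of $d$ (so $d^1=d$ and $d^{k+1}(n)=d(d^{k}(n))$). For an integer $n\ge 2$, the period $k(n)$ of $n$ is the smallest integer $k\ge 1$ such that $d^{k}(n)=2$. *)

theory Defs
  imports Complex_Main
begin

definition divisor_count :: "nat \<Rightarrow> nat" where
  "divisor_count n = card {m. m dvd n}"

definition period :: "nat \<Rightarrow> nat" where
  "period n = (LEAST k. k \<ge> 1 \<and> (divisor_count ^^ k) n = 2)"

text \<open>For \<open>n \<ge> 2\<close> the iterates do reach 2, so the \<open>LEAST\<close> above is a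
  genuine minimum; this is \<open>period_props\<close> below.\<close>

lemma divisor_count_2: "divisor_count 2 = 2"
proof -
  have "{m::nat. m dvd 2} = {1, 2}"
    using dvd_imp_le[of _ "2::nat"] by (force simp: le_Suc_eq numeral_2_eq_2)
  then show ?thesis by (simp add: divisor_count_def)
qed

lemma divisor_count_ge_2:
  assumes "n \<ge> 2" shows "divisor_count n \<ge> 2"
proof -
  have "card {1, n} \<le> card {m. m dvd n}"
    using assms by (intro card_mono finite_divisors_nat) auto
  then show ?thesis using assms by (simp add: divisor_count_def)
qed

lemma divisor_count_less:
  assumes "n > 2" shows "divisor_count n < n"
proof -
  have "\<not> n - 1 dvd n"
  proof
    assume "n - 1 dvd n"
    then have "n - 1 dvd n - (n - 1)" by (rule dvd_diff_nat) simp
    then show False using assms by simp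
  qed
  then have "{m. m dvd n} \<subseteq> {1..n} - {n - 1}"
    using assms dvd_imp_le[of _ n] dvd_pos_nat[of n] by (auto simp: Suc_le_eq)
  then have "card {m. m dvd n} \<le> card ({1..n} - {n - 1})"
    by (intro card_mono) auto
  then show ?thesis using assms by (simp add: divisor_count_def)
qed

lemma ex_iterate_divisor_count_eq_2:
  assumes "n \<ge> 2" shows "\<exists>k\<ge>1. (divisor_count ^^ k) n = 2"
  using assms
proof (induction n rule: less_induct)
  case (less n)
  show ?case
  proof (cases "n = 2")
    case True
    then show ?thesis by (intro exI[of _ 1]) (simp add: divisor_count_2)
  next
    case False
    then obtain k where "(divisor_count ^^ k) (divisor_count n) = 2"
      using less divisor_count_less[of n] divisor_count_ge_2[of n] by fastforce
    then have "(divisor_count ^^ Suc k) n = 2"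
      by (simp add: funpow_swap1)
    then show ?thesis by (intro exI[of _ "Suc k"]) simp
  qed
qed

lemma period_props:
  assumes "n \<ge> 2"
  shows "period n \<ge> 1" "(divisor_count ^^ period n) n = 2"
    "\<And>k. k \<ge> 1 \<Longrightarrow> (divisor_count ^^ k) n = 2 \<Longrightarrow> period n \<le> k"
  using LeastI_ex[of "\<lambda>k. k \<ge> 1 \<and> (divisor_count ^^ k) n = 2"]
    ex_iterate_divisor_count_eq_2[OF assms]
  by (auto simp: period_def intro: Least_le)

end

(* The divisors of n other than n itself are at most n / 2, so d(n) is at most
   3 n / 4 for n >= 3: each application of d lowers ln n by at least ln (4/3). *)

theory Submission
  imports Defs
begin

text \<open>Until it reaches its fixed point 2, the iteration of d shrinks its argument by a factor
  of at least 4/3 per step (\<open>four_divisor_count_le\<close>), so the number of steps is at most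
  the logarithm to base 4/3. Strong induction on n makes this precise in
  \<open>period_le_ln\<close>, with \<open>period_le_Suc_period_divisor_count\<close> counting one
  step.\<close>

lemma divisor_count_le:
  assumes "n > 0"
  shows "divisor_count n \<le> n div 2 + 1"
proof -
  have "{m. m dvd n} \<subseteq> insert n {1..n div 2}"
  proof
    fix m assume "m \<in> {m. m dvd n}"
    then obtain k where k: "n = m * k" by (auto elim: dvdE)
    show "m \<in> insert n {1..n div 2}"
    proof (cases "k = 1")
      case False
      \<comment> \<open>A proper divisor has cofactor at least 2.\<close>
      with k assms have "k \<ge> 2" "m \<ge> 1" by (auto intro: Suc_leI simp: numeral_2_eq_2)
      then have "m * 2 \<le> n" unfolding k by (intro mult_le_mono2)
      with \<open>m \<ge> 1\<close> show ?thesis by auto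
    qed (simp add: k)
  qed
  then have "card {m. m dvd n} \<le> card (insert n {1..n div 2})"
    by (intro card_mono) auto
  also have "\<dots> \<le> n div 2 + 1"
    using card_insert_le_m1[of "n div 2 + 1" "{1..n div 2}" n] by simp
  finally show ?thesis by (simp add: divisor_count_def)
qed

text \<open>For n \<ge> 4 already n/2 + 1 \<le> 3n/4; at n = 3 the rounding down in
  \<open>div\<close> is what saves the bound. It fails at the fixed point n = 2.\<close>

lemma four_divisor_count_le:
  assumes "n \<ge> 3"
  shows "4 * divisor_count n \<le> 3 * n"
proof -
  have "4 * (n div 2 + 1) \<le> 3 * n" using assms by presburger
  then show ?thesis using divisor_count_le[of n] assms by simp
qed

text \<open>Equality fails for prime n: there d(n) = 2, and since exponents start at 1,
  \<open>period 2\<close> is 1 rather than 0.\<close>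

lemma period_le_Suc_period_divisor_count:
  assumes "n \<ge> 2"
  shows "period n \<le> Suc (period (divisor_count n))"
proof (rule period_props(3)[OF assms])
  show "(divisor_count ^^ Suc (period (divisor_count n))) n = 2"
    using period_props(2)[OF divisor_count_ge_2[OF assms]] by (simp add: funpow_swap1)
qed simp

lemma period_le_ln:
  assumes "n \<ge> 2"
  shows "real (period n) \<le> ln (real n) / ln (4 / 3)"
  using assms
proof (induction n rule: less_induct)
  case (less n)
  show ?case
  proof (cases "n = 2")
    case True
    \<comment> \<open>No descent is available at the fixed point; the bound holds here because 2
      \<ge> 4/3.\<close>
    have "period 2 \<le> 1" by (rule period_props(3)) (simp_all add: divisor_count_2)
    moreover have "1 \<le> ln 2 / ln (4 / 3 :: real)" by simp
    ultimately have "real (period 2) \<le> ln 2 / ln (4 / 3)" by linarith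
    then show ?thesis using True by simp
  next
    case False
    let ?d = "divisor_count n"
    have d: "?d \<ge> 2" "?d < n"
      using less.prems False divisor_count_ge_2 divisor_count_less by auto
    have "4 * ?d \<le> 3 * n"
      using less.prems False by (intro four_divisor_count_le) simp
    then have "4 / 3 * real ?d \<le> real n" by simp
    \<comment> \<open>In logarithms to base 4/3 the shrinking becomes a drop of at least 1, which
      pays for the extra step in the period.\<close>
    then have "ln (4 / 3 * real ?d) \<le> ln (real n)" using d by (intro ln_mono) auto
    then have "ln (4 / 3) + ln (real ?d) \<le> ln (real n)" using d by (subst (asm) ln_mult_pos) auto
    then have "(ln (4 / 3) + ln (real ?d)) / ln (4 / 3) \<le> ln (real n) / ln (4 / 3)"
      by (rule divide_right_mono) simp
    then have "1 + ln (real ?d) / ln (4 / 3) \<le> ln (real n) / ln (4 / 3)"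
      by (simp add: add_divide_distrib)
    moreover have "real (period ?d) \<le> ln (real ?d) / ln (4 / 3)"
      using less.IH d by simp
    ultimately show ?thesis
      using period_le_Suc_period_divisor_count[OF less.prems] by linarith
  qed
qed

theorem theorem2:
  shows "\<exists>C::real. C > 0 \<and> (\<forall>n::nat. n \<ge> 2 \<longrightarrow> real (period n) \<le> C * ln (real n))"
  using period_le_ln by (intro exI[of _ "1 / ln (4 / 3)"]) simp

end
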